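(* For every $n\ge 1$ and every $A\in M_2(\mathbb{C})^{\otimes n}$, $$\big\|A-2^{-n}\operatorname{tr}(A)\mathbf 1\big\|_1\le \sum_{j=1}^n \|d_jA\|_1 .$$
   Context: $M_2(\mathbb{C})^{\otimes n}\cong M_{2^n}(\mathbb{C})$ is the algebra of operators on $n$ qubits, $\operatorname{tr}$ its (unnormalized) trace, $\mathbf 1$ its identity. Normalized Schatten norm: $\|A\|_p=(2^{-n}\operatorname{tr}|A|^p)^{1/p}$, $|A|=(A^*A)^{1/2}$. For $1\le j\le n$, $d_j=\mathbb I^{\otimes(j-1)}\otimes(\mathbb I-\tfrac12\operatorname{tr}(\cdot)\mathbf 1)\otimes\mathbb I^{\otimes(n-j)}$, where $\mathbb I$ is the identity map on $M_2(\mathbb{C})$. *)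

theory Defs
  imports "Jordan_Normal_Form.Schur_Decomposition"
begin

definition mat_trace :: "complex mat \<Rightarrow> complex" where
  "mat_trace A = (\<Sum>i<dim_row A. A $$ (i, i))"

definition positive_semidefinite :: "complex mat \<Rightarrow> bool" where
  "positive_semidefinite P \<longleftrightarrow>
     square_mat P \<and> mat_adjoint P = P \<and>
     (\<forall>v \<in> carrier_vec (dim_row P). Re ((P *\<^sub>v v) \<bullet>c v) \<ge> 0)"

text \<open>The positive square root; a positive semidefinite matrix has exactly one.\<close>

definition mat_sqrt :: "complex mat \<Rightarrow> complex mat" where
  "mat_sqrt P = (THE S. positive_semidefinite S \<and> S * S = P)"

definition mat_abs :: "complex mat \<Rightarrow> complex mat" where
  "mat_abs A = mat_sqrt (mat_adjoint A * A)"

text \<open>The normalized Schatten norm with exponent 1 on n qubits. The trace of the absolute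
  value is a nonnegative real, so taking the real part only adjusts the type.\<close>

definition schatten1 :: "nat \<Rightarrow> complex mat \<Rightarrow> real" where
  "schatten1 n A = Re (mat_trace (mat_abs A)) / 2 ^ n"

text \<open>A row or column index \<open>x < 2 ^ n\<close> encodes a computational basis vector of n qubits;
  qubit k (numbered from 1) is the k-th binary digit, most significant first, which is the
  convention of the Kronecker product.\<close>

definition qubit :: "nat \<Rightarrow> nat \<Rightarrow> nat \<Rightarrow> nat" where
  "qubit n k x = x div 2 ^ (n - k) mod 2"

text \<open>The Kronecker product of the 2 by 2 matrices \<open>B 1, \<dots>, B n\<close>.\<close>

definition tensor_mat :: "nat \<Rightarrow> (nat \<Rightarrow> complex mat) \<Rightarrow> complex mat" where
  "tensor_mat n B =
     mat (2 ^ n) (2 ^ n) (\<lambda>(x, y). \<Prod>k\<in>{1..n}. B k $$ (qubit n k x, qubit n k y))"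

definition mat_unit :: "nat \<Rightarrow> nat \<Rightarrow> complex mat" where
  "mat_unit a b = mat 2 2 (\<lambda>(i, j). if i = a \<and> j = b then 1 else 0)"

text \<open>The tensor product of the linear maps \<open>\<Phi> 1, \<dots>, \<Phi> n\<close> on 2 by 2 matrices: the matrix
  unit at position (a, b) is the Kronecker product of the one-qubit matrix units at positions
  given by the digits of a and b; it is sent to the Kronecker product of their images, and
  this is extended linearly.\<close>

definition tensor_map :: "nat \<Rightarrow> (nat \<Rightarrow> complex mat \<Rightarrow> complex mat) \<Rightarrow> complex mat \<Rightarrow> complex mat"
  where
  "tensor_map n \<Phi> A =
     mat (2 ^ n) (2 ^ n) (\<lambda>(x, y).
       \<Sum>a<2 ^ n. \<Sum>b<2 ^ n.
         A $$ (a, b) *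
         tensor_mat n (\<lambda>k. \<Phi> k (mat_unit (qubit n k a) (qubit n k b))) $$ (x, y))"

definition center_map :: "complex mat \<Rightarrow> complex mat" where
  "center_map X = X - (mat_trace X / 2) \<cdot>\<^sub>m 1\<^sub>m 2"

definition qubit_diff :: "nat \<Rightarrow> nat \<Rightarrow> complex mat \<Rightarrow> complex mat" where
  "qubit_diff n j = tensor_map n (\<lambda>k. if k = j then center_map else (\<lambda>X. X))"

lemma qubit_less_2: "qubit n k x < 2"
  by (simp add: qubit_def)

lemma qubit_Suc_last: "qubit (Suc n) (Suc n) x = x mod 2"
  by (simp add: qubit_def)

lemma qubit_Suc: "k \<le> n \<Longrightarrow> qubit (Suc n) k x = qubit n k (x div 2)"
  by (simp add: qubit_def Suc_diff_le div_mult2_eq)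

lemma sum_qubits_prod:
  fixes f :: "nat \<Rightarrow> nat \<Rightarrow> nat \<Rightarrow> complex"
  shows "(\<Sum>a<2 ^ n. \<Sum>b<2 ^ n. \<Prod>k\<in>{1..n}. f k (qubit n k a) (qubit n k b)) =
         (\<Prod>k\<in>{1..n}. \<Sum>a<2. \<Sum>b<2. f k a b)"
proof (induction n)
  case 0
  then show ?case by simp
next
  case (Suc n)
  have split: "(\<Sum>a<2 ^ Suc n. g a) = (\<Sum>a<2 ^ n. \<Sum>c<2. g (2 * a + c))" for g :: "nat \<Rightarrow> complex"
    using sum.nat_group[of g 2 "2 ^ n"]
    by (simp add: mult.commute lessThan_atLeast0 sum.shift_bounds_nat_ivl eval_nat_numeral)
  have dig: "(\<Prod>k\<in>{1..Suc n}. f k (qubit (Suc n) k (2 * a + c)) (qubit (Suc n) k (2 * b + d))) =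
     (\<Prod>k\<in>{1..n}. f k (qubit n k a) (qubit n k b)) * f (Suc n) c d" if "c < 2" "d < 2" for a b c d
    using that by (auto simp: qubit_Suc qubit_Suc_last intro!: prod.cong)
  have "(\<Sum>a<2 ^ Suc n. \<Sum>b<2 ^ Suc n. \<Prod>k\<in>{1..Suc n}. f k (qubit (Suc n) k a) (qubit (Suc n) k b)) =
     (\<Sum>a<2 ^ n. \<Sum>c<2. \<Sum>b<2 ^ n. \<Sum>d<2.
        (\<Prod>k\<in>{1..n}. f k (qubit n k a) (qubit n k b)) * f (Suc n) c d)"
    unfolding split by (intro sum.cong refl dig) auto
  also have "\<dots> = (\<Sum>a<2 ^ n. \<Sum>b<2 ^ n. \<Sum>c<2. \<Sum>d<2.
        (\<Prod>k\<in>{1..n}. f k (qubit n k a) (qubit n k b)) * f (Suc n) c d)"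
    by (intro sum.cong refl sum.swap)
  also have "\<dots> = (\<Sum>a<2 ^ n. \<Sum>b<2 ^ n. \<Prod>k\<in>{1..n}. f k (qubit n k a) (qubit n k b)) *
        (\<Sum>c<2. \<Sum>d<2. f (Suc n) c d)"
    by (simp only: sum_distrib_left[symmetric] sum_distrib_right[symmetric])
  finally show ?case using Suc.IH by simp
qed

text \<open>On an elementary tensor, \<open>qubit_diff\<close> acts in the j-th factor only.\<close>

lemma qubit_diff_tensor_mat:
  assumes B: "\<And>k. k \<in> {1..n} \<Longrightarrow> B k \<in> carrier_mat 2 2"
  shows "qubit_diff n j (tensor_mat n B) = tensor_mat n (\<lambda>k. if k = j then center_map (B k) else B k)"
    (is "?L = ?R")
proof (rule eq_matI)
  let ?G = "\<lambda>k. if k = j then center_map else (\<lambda>X. X)"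
  show "dim_row ?L = dim_row ?R" "dim_col ?L = dim_col ?R"
    by (simp_all add: qubit_diff_def tensor_map_def tensor_mat_def)
  fix x y assume "x < dim_row ?R" "y < dim_col ?R"
  then have x: "x < 2 ^ n" and y: "y < 2 ^ n" by (simp_all add: tensor_mat_def)
  have lin: "(\<Sum>a<2. \<Sum>b<2. B k $$ (a, b) * ?G k (mat_unit a b) $$ (u, v)) = ?G k (B k) $$ (u, v)"
    if "k \<in> {1..n}" "u < 2" "v < 2" for k u v
    using B[OF that(1)] that(2,3)
    by (auto simp: center_map_def mat_trace_def mat_unit_def eval_nat_numeral less_Suc_eq
        field_simps)
  have "?L $$ (x, y) = (\<Sum>a<2 ^ n. \<Sum>b<2 ^ n. \<Prod>k\<in>{1..n}.
      B k $$ (qubit n k a, qubit n k b) *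
      ?G k (mat_unit (qubit n k a) (qubit n k b)) $$ (qubit n k x, qubit n k y))"
    using x y by (simp add: qubit_diff_def tensor_map_def tensor_mat_def prod.distrib)
  also have "\<dots> = (\<Prod>k\<in>{1..n}. \<Sum>a<2. \<Sum>b<2.
      B k $$ (a, b) * ?G k (mat_unit a b) $$ (qubit n k x, qubit n k y))"
    by (rule sum_qubits_prod)
  also have "\<dots> = (\<Prod>k\<in>{1..n}. ?G k (B k) $$ (qubit n k x, qubit n k y))"
    by (intro prod.cong refl lin qubit_less_2)
  also have "\<dots> = ?R $$ (x, y)"
    using x y by (auto simp: tensor_mat_def intro!: prod.cong)
  finally show "?L $$ (x, y) = ?R $$ (x, y)" .
qed

end

(* For a contraction W, Re tr (W A) is at most the trace of |A|, with equality for a suitable W.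
   So the trace norm is subadditive, and an average of unitary conjugates of A has at most the
   trace norm of A.  Averaging over the Pauli matrices of qubit j gives the conditional expectation
   E_j that replaces this qubit by its normalized trace, and d_j = 1 - E_j.  As
   A - E_n ... E_1 A is the sum over j of E_n ... E_(j+1) (d_j A), with E_n ... E_1 A equal to
   tr A / 2^n times the identity, the contractivity of each E_i yields the claim. *)
theory Submission
  imports Defs "Jordan_Normal_Form.Spectral_Radius" "HOL-Analysis.L2_Norm"
begin

subsection \<open>Adjoints and unitary diagonalization\<close>

text \<open>\<open>mat_sqrt\<close> is a definite description, so nothing is known about
  \<open>mat_abs A\<close> until positive square roots are shown to exist and to be unique. Both
  facts rest on the diagonalization of Hermitian matrices. No singular value or polar decomposition
  of A is formed: an eigenbasis of |A| serves both halves of the duality, through Cauchy-Schwarz for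
  the bound and a pseudoinverse of |A| for the equality. The detour through contractions pays
  because |A| is not linear in A, while tr (W A) is, and a unitary conjugation of A can be moved
  over to W by cyclicity of the trace. The average over the four Pauli matrices is taken as two
  averages of two terms, over {1, Z} and then over {1, X}. Tensor factors are handled through binary
  digits of indices: flipping one qubit is XOR with a power of two, which gives \<open>E_j\<close>
  and the composites of several \<open>E_j\<close> explicit entries.\<close>

lemma dim_mat_adjoint [simp]:
  "dim_row (mat_adjoint A) = dim_col A" "dim_col (mat_adjoint A) = dim_row A"
  by (simp_all add: mat_adjoint_def)

lemma index_mat_adjoint [simp]:
  fixes A :: "complex mat"
  assumes "i < dim_col A" "j < dim_row A"
  shows "mat_adjoint A $$ (i, j) = cnj (A $$ (j, i))"
  using assms by (simp add: mat_adjoint_def mat_of_rows_def)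

lemma mat_adjoint_carrier [simp]:
  "A \<in> carrier_mat m n \<Longrightarrow> mat_adjoint A \<in> carrier_mat n m"
  by (rule carrier_matI) (simp_all add: carrier_matD)

lemma mat_adjoint_adjoint [simp]: "mat_adjoint (mat_adjoint A) = (A :: complex mat)"
  by (rule eq_matI) simp_all

lemma mat_adjoint_one [simp]: "mat_adjoint (1\<^sub>m n :: complex mat) = 1\<^sub>m n"
  by (rule eq_matI) simp_all

lemma mult_carrier_square_mat [simp]:
  "A \<in> carrier_mat n n \<Longrightarrow> B \<in> carrier_mat n n \<Longrightarrow> A * B \<in> carrier_mat n n"
  by (rule mult_carrier_mat)

lemma index_mult_mat_sum:
  assumes "A \<in> carrier_mat l m" "B \<in> carrier_mat m n" "i < l" "j < n"
  shows "(A * B) $$ (i, j) = (\<Sum>k<m. A $$ (i, k) * B $$ (k, j))"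
  using assms by (simp add: scalar_prod_def atLeast0LessThan)

lemma mat_adjoint_mult:
  fixes A B :: "complex mat"
  assumes A: "A \<in> carrier_mat l m" and B: "B \<in> carrier_mat m n"
  shows "mat_adjoint (A * B) = mat_adjoint B * mat_adjoint A"
proof (rule eq_matI)
  fix i j assume "i < dim_row (mat_adjoint B * mat_adjoint A)" "j < dim_col (mat_adjoint B * mat_adjoint A)"
  then have i: "i < n" and j: "j < l" using A B by auto
  have "mat_adjoint (A * B) $$ (i, j) = cnj ((A * B) $$ (j, i))"
    using A B i j by (intro index_mat_adjoint) auto
  also have "\<dots> = (\<Sum>k<m. mat_adjoint B $$ (i, k) * mat_adjoint A $$ (k, j))"
    unfolding index_mult_mat_sum[OF A B j i] using A B i j by (simp add: mult.commute)
  also have "\<dots> = (mat_adjoint B * mat_adjoint A) $$ (i, j)"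
    using A B i j by (intro index_mult_mat_sum[symmetric]) auto
  finally show "mat_adjoint (A * B) $$ (i, j) = (mat_adjoint B * mat_adjoint A) $$ (i, j)" .
qed (use A B in auto)

lemma mat_adjoint_minus:
  fixes A B :: "complex mat"
  assumes "A \<in> carrier_mat m n" "B \<in> carrier_mat m n"
  shows "mat_adjoint (A - B) = mat_adjoint A - mat_adjoint B"
  using assms by (intro eq_matI) auto

lemma cscalar_prod_sum:
  fixes v w :: "complex vec"
  assumes "v \<in> carrier_vec n" "w \<in> carrier_vec n"
  shows "v \<bullet>c w = (\<Sum>i<n. v $ i * cnj (w $ i))"
  using assms by (simp add: scalar_prod_def atLeast0LessThan)

lemma index_mult_mat_vec_sum:
  assumes "A \<in> carrier_mat m n" "v \<in> carrier_vec n" "i < m"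
  shows "(A *\<^sub>v v) $ i = (\<Sum>j<n. A $$ (i, j) * v $ j)"
  using assms by (simp add: scalar_prod_def atLeast0LessThan)

lemma cscalar_prod_mult_adjoint:
  fixes A :: "complex mat"
  assumes A: "A \<in> carrier_mat m n" and v: "v \<in> carrier_vec n" and w: "w \<in> carrier_vec m"
  shows "(A *\<^sub>v v) \<bullet>c w = v \<bullet>c (mat_adjoint A *\<^sub>v w)"
proof -
  have "(A *\<^sub>v v) \<bullet>c w = (\<Sum>i<m. \<Sum>j<n. A $$ (i, j) * v $ j * cnj (w $ i))"
    using A v w by (simp add: cscalar_prod_sum[of _ m] index_mult_mat_vec_sum[OF A v] sum_distrib_right
        del: index_mult_mat_vec)
  also have "\<dots> = (\<Sum>j<n. \<Sum>i<m. A $$ (i, j) * v $ j * cnj (w $ i))"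
    by (rule sum.swap)
  also have "\<dots> = (\<Sum>j<n. v $ j * cnj ((mat_adjoint A *\<^sub>v w) $ j))"
  proof (intro sum.cong refl)
    fix j assume "j \<in> {..<n}"
    then have j: "j < n" by simp
    have "(mat_adjoint A *\<^sub>v w) $ j = (\<Sum>i<m. mat_adjoint A $$ (j, i) * w $ i)"
      using A w j by (intro index_mult_mat_vec_sum) auto
    then show "(\<Sum>i<m. A $$ (i, j) * v $ j * cnj (w $ i)) = v $ j * cnj ((mat_adjoint A *\<^sub>v w) $ j)"
      using A j by (simp add: sum_distrib_left mult_ac del: index_mult_mat_vec)
  qed
  also have "\<dots> = v \<bullet>c (mat_adjoint A *\<^sub>v w)"
    using cscalar_prod_sum[OF v mult_mat_vec_carrier[OF mat_adjoint_carrier[OF A] w]] by simp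
  finally show ?thesis .
qed

lemma cscalar_prod_self:
  fixes v :: "complex vec"
  shows "v \<bullet>c v = of_real (\<Sum>i<dim_vec v. (cmod (v $ i))\<^sup>2)"
  by (simp add: scalar_prod_def atLeast0LessThan complex_norm_square del: of_real_power)

lemma cscalar_prod_self_pos:
  fixes v :: "complex vec"
  assumes "v \<in> carrier_vec n" "v \<noteq> 0\<^sub>v n"
  shows "Re (v \<bullet>c v) > 0"
proof -
  have "Re (v \<bullet>c v) \<ge> 0"
    by (simp add: cscalar_prod_self sum_nonneg)
  moreover have "v \<bullet>c v \<noteq> 0"
    using conjugate_square_eq_0_vec[OF assms(1)] assms(2) by auto
  moreover have "Im (v \<bullet>c v) = 0"
    by (simp add: cscalar_prod_self)
  ultimately show ?thesis
    by (auto simp: complex_eq_iff less_le)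
qed

section \<open>Unitary matrices and the spectral theorem for Hermitian matrices\<close>

definition unitary_mat :: "nat \<Rightarrow> complex mat \<Rightarrow> bool" where
  "unitary_mat n U \<longleftrightarrow> U \<in> carrier_mat n n \<and> mat_adjoint U * U = 1\<^sub>m n"

text \<open>A left inverse of a square matrix is also a right inverse, which supplies the third
  fact.\<close>

lemma unitary_matD:
  assumes "unitary_mat n U"
  shows "U \<in> carrier_mat n n" "mat_adjoint U * U = 1\<^sub>m n" "U * mat_adjoint U = 1\<^sub>m n"
  using assms mat_mult_left_right_inverse[of "mat_adjoint U" n U]
  by (auto simp: unitary_mat_def)

lemma unitary_mat_adjoint:
  assumes "unitary_mat n U"
  shows "unitary_mat n (mat_adjoint U)"
  using unitary_matD[OF assms] by (simp add: unitary_mat_def)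

lemma mat_mult_cancel_middle:
  fixes A B C D :: "'a :: semiring_1 mat"
  assumes "A \<in> carrier_mat n n" "B \<in> carrier_mat n n" "C \<in> carrier_mat n n" "D \<in> carrier_mat n n"
    and "B * C = 1\<^sub>m n"
  shows "(A * B) * (C * D) = A * D"
proof -
  have "(A * B) * (C * D) = A * ((B * C) * D)"
    using assms(1-4) by (simp add: assoc_mult_mat[of _ n n _ n _ n])
  then show ?thesis using assms by simp
qed

lemma unitary_mat_mult:
  assumes "unitary_mat n U" "unitary_mat n V"
  shows "unitary_mat n (U * V)"
proof -
  note U = unitary_matD[OF assms(1)] and V = unitary_matD[OF assms(2)]
  have "mat_adjoint (U * V) * (U * V) = (mat_adjoint V * mat_adjoint U) * (U * V)"
    using U V by (simp add: mat_adjoint_mult[of _ n n _ n])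
  also have "\<dots> = 1\<^sub>m n"
    using U V by (subst mat_mult_cancel_middle[of _ n]) auto
  finally show ?thesis using U V by (simp add: unitary_mat_def)
qed

text \<open>Completing v to a basis and orthogonalizing gives the columns; c is the normalizing
  factor. With v an eigenvector, this U performs one deflation step.\<close>

lemma unitary_with_first_column:
  fixes v :: "complex vec"
  assumes v: "v \<in> carrier_vec n" "v \<noteq> 0\<^sub>v n"
  obtains U c where "unitary_mat n U" "col U 0 = c \<cdot>\<^sub>v v"
proof -
  interpret cof_vec_space n "TYPE(complex)" .
  define ws where "ws = gram_schmidt n (basis_completion v)"
  note b = basis_completion[OF v]
  note gs = gram_schmidt_result[OF b(2,4,5) ws_def]
  have n: "n > 0" using v by (cases n) auto
  have len: "length ws = n" using gs(4) b(6) by simp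
  have car: "ws ! i \<in> carrier_vec n" if "i < n" for i using gs(3) len that by auto
  have "\<exists>vs. basis_completion v = v # vs"
    using b(6,7) n by (cases "basis_completion v") auto
  \<comment> \<open>Gram-Schmidt leaves the first vector of the list unchanged.\<close>
  then have "hd ws = v" unfolding ws_def using v by auto
  then have w0: "ws ! 0 = v" using hd_conv_nth[of ws] len n by fastforce
  \<comment> \<open>\<open>gram_schmidt\<close> yields orthogonal vectors of arbitrary positive
    length; r rescales them to unit length.\<close>
  define r where "r j = 1 / sqrt (Re (ws ! j \<bullet>c ws ! j))" for j
  have orth: "(ws ! i \<bullet>c ws ! j = 0) = (i \<noteq> j)" if "i < n" "j < n" for i j
    using corthogonalD[OF gs(2)] that len by simp
  have pos: "Re (ws ! j \<bullet>c ws ! j) > 0" if "j < n" for j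
  proof (rule cscalar_prod_self_pos[OF car[OF that]])
    show "ws ! j \<noteq> 0\<^sub>v n" using orth[OF that that] by auto
  qed
  define U where "U = mat n n (\<lambda>(i, j). of_real (r j) * ws ! j $ i)"
  have U: "U \<in> carrier_mat n n" by (simp add: U_def)
  have "mat_adjoint U * U = 1\<^sub>m n"
  proof (rule eq_matI)
    fix i j assume "i < dim_row (1\<^sub>m n :: complex mat)" "j < dim_col (1\<^sub>m n :: complex mat)"
    then have ij: "i < n" "j < n" by auto
    have "(mat_adjoint U * U) $$ (i, j) = (\<Sum>k<n. cnj (U $$ (k, i)) * U $$ (k, j))"
      using ij U by (subst index_mult_mat_sum[of _ n n _ n]) auto
    also have "\<dots> = (\<Sum>k<n. of_real (r i * r j) * (ws ! j $ k * cnj (ws ! i $ k)))"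
      using ij by (intro sum.cong) (auto simp: U_def)
    also have "\<dots> = of_real (r i * r j) * (ws ! j \<bullet>c ws ! i)"
      using car[OF ij(1)] car[OF ij(2)]
      by (simp add: scalar_prod_def sum_distrib_left atLeast0LessThan)
    also have "\<dots> = 1\<^sub>m n $$ (i, j)"
    proof (cases "i = j")
      case True
      have "ws ! j \<bullet>c ws ! j = of_real (Re (ws ! j \<bullet>c ws ! j))"
        by (simp add: cscalar_prod_self)
      moreover have "r j * r j * Re (ws ! j \<bullet>c ws ! j) = 1"
        using pos[OF ij(2)] by (simp add: r_def field_simps)
      ultimately show ?thesis using True ij by (metis index_one_mat(1) of_real_1 of_real_mult)
    next
      case False
      then have "ws ! j \<bullet>c ws ! i = 0" using orth ij by auto
      then show ?thesis using False ij by simp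
    qed
    finally show "(mat_adjoint U * U) $$ (i, j) = 1\<^sub>m n $$ (i, j)" .
  qed (use U in auto)
  moreover have "col U 0 = of_real (r 0) \<cdot>\<^sub>v v"
    using n v w0 by (intro eq_vecI) (auto simp: U_def)
  ultimately show ?thesis using U that by (auto simp: unitary_mat_def)
qed

definition real_diag :: "nat \<Rightarrow> (nat \<Rightarrow> real) \<Rightarrow> complex mat" where
  "real_diag n d = mat n n (\<lambda>(i, j). if i = j then of_real (d i) else 0)"

lemma real_diag_carrier [simp]: "real_diag n d \<in> carrier_mat n n"
  by (simp add: real_diag_def)

lemma real_diag_dim [simp]: "dim_row (real_diag n d) = n" "dim_col (real_diag n d) = n"
  by (simp_all add: real_diag_def)

lemma mat_adjoint_real_diag [simp]: "mat_adjoint (real_diag n d) = real_diag n d"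
  by (rule eq_matI) (auto simp: real_diag_def)

lemma real_diag_mult: "real_diag n d * real_diag n e = real_diag n (\<lambda>i. d i * e i)"
proof (rule eq_matI)
  fix i j assume "i < dim_row (real_diag n (\<lambda>i. d i * e i))" "j < dim_col (real_diag n (\<lambda>i. d i * e i))"
  then have "i < n" "j < n" by auto
  then show "(real_diag n d * real_diag n e) $$ (i, j) = real_diag n (\<lambda>i. d i * e i) $$ (i, j)"
    by (subst index_mult_mat_sum[of _ n n _ n])
       (auto simp: real_diag_def if_distrib[of "\<lambda>x. x * _"] cong: if_cong)
qed auto

text \<open>Induction on the dimension by deflation. Conjugating with a unitary whose first column
  is an eigenvector turns the first column into (e, 0, ..., 0); Hermitian symmetry then clears the
  first row, and the remaining block is Hermitian of dimension one less.\<close>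

lemma hermitian_diagonalizable:
  assumes "A \<in> carrier_mat n n" "mat_adjoint A = A"
  obtains U d where "unitary_mat n U" "A = U * real_diag n d * mat_adjoint U"
proof -
  have "\<exists>U d. unitary_mat n U \<and> A = U * real_diag n d * mat_adjoint U"
    using assms
  proof (induction n arbitrary: A)
    case 0
    then have "A = 1\<^sub>m 0 * real_diag 0 d * mat_adjoint (1\<^sub>m 0)" for d
      by (intro eq_matI) auto
    moreover have "unitary_mat 0 (1\<^sub>m 0)" by (simp add: unitary_mat_def)
    ultimately show ?case by blast
  next
    case (Suc m)
    let ?n = "Suc m"
    have A: "A \<in> carrier_mat ?n ?n" and herm: "mat_adjoint A = A" using Suc.prems by auto
    obtain e where "eigenvalue A e"
      using spectrum_non_empty[OF A] by (auto simp: spectrum_def)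
    then obtain v where v: "v \<in> carrier_vec ?n" "v \<noteq> 0\<^sub>v ?n" and Av: "A *\<^sub>v v = e \<cdot>\<^sub>v v"
      using A by (auto simp: eigenvalue_def eigenvector_def)
    obtain U c where unit: "unitary_mat ?n U" and col0: "col U 0 = c \<cdot>\<^sub>v v"
      using unitary_with_first_column[OF v] .
    note U = unitary_matD[OF unit]
    define B where "B = mat_adjoint U * A * U"
    have B: "B \<in> carrier_mat ?n ?n" using U A by (simp add: B_def)
    have hermB: "mat_adjoint B = B"
      using U A herm by (simp add: B_def mat_adjoint_mult[of _ ?n ?n _ ?n] assoc_mult_mat[of _ ?n ?n _ ?n _ ?n])
    have AU0: "(A * U) $$ (k, 0) = e * U $$ (k, 0)" if "k < ?n" for k
    proof -
      have "(A * U) $$ (k, 0) = (A *\<^sub>v col U 0) $ k" using that A U by simp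
      also have "A *\<^sub>v col U 0 = e \<cdot>\<^sub>v col U 0"
        using A v by (simp add: col0 mult_mat_vec[of _ ?n ?n] Av smult_smult_assoc mult.commute)
      finally show ?thesis using that U by simp
    qed
    have B0: "B $$ (i, 0) = (if i = 0 then e else 0)" if "i < ?n" for i
    proof -
      have "B $$ (i, 0) = (mat_adjoint U * (A * U)) $$ (i, 0)"
        using U A by (simp add: B_def assoc_mult_mat[of _ ?n ?n _ ?n _ ?n])
      also have "\<dots> = (\<Sum>k<?n. mat_adjoint U $$ (i, k) * (e * U $$ (k, 0)))"
        using that U A by (subst index_mult_mat_sum[of _ ?n ?n _ ?n]) (auto simp: AU0 simp del: index_mult_mat)
      also have "\<dots> = e * (mat_adjoint U * U) $$ (i, 0)"
        using that U(1) by (subst index_mult_mat_sum[of _ ?n ?n _ ?n]) (auto simp: sum_distrib_left mult_ac simp del: sum.lessThan_Suc)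
      finally show ?thesis using that U by simp
    qed
    have Bsym: "B $$ (i, j) = cnj (B $$ (j, i))" if "i < ?n" "j < ?n" for i j
      using that B hermB index_mat_adjoint[of i B j] by simp
    \<comment> \<open>The eigenvalue sits on the diagonal of \<open>B\<close>, hence equals its own
      conjugate.\<close>
    have "Im e = 0"
      using B0[of 0] Bsym[of 0 0] by (simp add: complex_eq_iff)
    then obtain r where e: "e = of_real r"
      by (metis complex_is_Real_iff Reals_cases)
    have B0': "B $$ (0, j) = (if j = 0 then e else 0)" if "j < ?n" for j
      using Bsym[of 0 j] B0[OF that] that e by (cases "j = 0") auto
    define C where "C = mat m m (\<lambda>(i, j). B $$ (Suc i, Suc j))"
    have C: "C \<in> carrier_mat m m" by (simp add: C_def)
    have "mat_adjoint C = C"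
      using Bsym[symmetric] by (intro eq_matI) (auto simp: C_def)
    then obtain V d where unitV: "unitary_mat m V" and CV: "C = V * real_diag m d * mat_adjoint V"
      using Suc.IH[OF C] by blast
    note V = unitary_matD[OF unitV]
    \<comment> \<open>Block diagonal matrices multiply and take adjoints blockwise, so the
      diagonalization of \<open>C\<close> lifts to \<open>B\<close> by putting 1 in the corner of
      \<open>V\<close>.\<close>
    define blk :: "complex \<Rightarrow> complex mat \<Rightarrow> complex mat" where
      "blk a X = four_block_mat (a \<cdot>\<^sub>m 1\<^sub>m 1) (0\<^sub>m 1 m) (0\<^sub>m m 1) X" for a X
    have blk_car: "blk a X \<in> carrier_mat ?n ?n" if "X \<in> carrier_mat m m" for a X
      using that by (auto simp: blk_def)
    have blk_mult: "blk a X * blk b Y = blk (a * b) (X * Y)"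
      if "X \<in> carrier_mat m m" "Y \<in> carrier_mat m m" for a b X Y
      unfolding blk_def using that
      by (subst mult_four_block_mat[of _ 1 1 _ m _ m _ _ 1 _ m]) (auto simp: smult_smult_assoc intro!: cong_four_block_mat)
    have blk_adj: "mat_adjoint (blk a X) = blk (cnj a) (mat_adjoint X)"
      if "X \<in> carrier_mat m m" for a X
      using that by (intro eq_matI) (auto simp: blk_def)
    have blk_one: "blk 1 (1\<^sub>m m) = 1\<^sub>m ?n"
      by (rule eq_matI) (auto simp: blk_def)
    have "B = blk e C"
      using B by (intro eq_matI) (auto simp: blk_def C_def B0 B0')
    define W where "W = blk 1 V"
    have W: "unitary_mat ?n W"
      using V blk_car blk_one by (simp add: unitary_mat_def W_def blk_adj blk_mult del: carrier_matD)
    define d' where "d' i = (case i of 0 \<Rightarrow> r | Suc k \<Rightarrow> d k)" for i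
    have diag: "real_diag ?n d' = blk e (real_diag m d)"
      using e by (intro eq_matI) (auto simp: blk_def real_diag_def d'_def split: nat.splits)
    have BW: "B = W * real_diag ?n d' * mat_adjoint W"
      using V by (simp add: \<open>B = blk e C\<close> CV diag W_def blk_adj blk_mult)
    note W' = unitary_matD[OF W]
    have "A = (U * mat_adjoint U) * A * (U * mat_adjoint U)" using U A by simp
    also have "\<dots> = U * B * mat_adjoint U"
      using U(1) A by (simp add: B_def assoc_mult_mat[of _ ?n ?n _ ?n _ ?n])
    also have "\<dots> = (U * W) * real_diag ?n d' * mat_adjoint (U * W)"
      using U(1) W'(1) by (simp add: BW mat_adjoint_mult[of _ ?n ?n _ ?n] assoc_mult_mat[of _ ?n ?n _ ?n _ ?n])
    finally show ?case using unitary_mat_mult[OF unit W] by blast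
  qed
  then show ?thesis using that by blast
qed

subsection \<open>Positive semidefinite matrices\<close>

lemma mat_trace_carrier: "A \<in> carrier_mat n n \<Longrightarrow> mat_trace A = (\<Sum>i<n. A $$ (i, i))"
  by (simp add: mat_trace_def carrier_matD)

lemma mat_trace_mult_comm:
  assumes A: "A \<in> carrier_mat n n" and B: "B \<in> carrier_mat n n"
  shows "mat_trace (A * B) = mat_trace (B * A)"
proof -
  have "mat_trace (A * B) = (\<Sum>i<n. \<Sum>k<n. A $$ (i, k) * B $$ (k, i))"
    unfolding mat_trace_carrier[OF mult_carrier_mat[OF A B]]
    by (intro sum.cong refl index_mult_mat_sum[OF A B]) auto
  also have "\<dots> = (\<Sum>k<n. \<Sum>i<n. B $$ (k, i) * A $$ (i, k))"
    by (subst sum.swap) (simp add: mult.commute)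
  also have "\<dots> = mat_trace (B * A)"
    unfolding mat_trace_carrier[OF mult_carrier_mat[OF B A]]
    by (intro sum.cong refl index_mult_mat_sum[OF B A, symmetric]) auto
  finally show ?thesis .
qed

lemma mat_trace_add:
  "A \<in> carrier_mat n n \<Longrightarrow> B \<in> carrier_mat n n \<Longrightarrow> mat_trace (A + B) = mat_trace A + mat_trace B"
  by (simp add: mat_trace_carrier[of _ n] sum.distrib)

lemma mat_trace_smult:
  "A \<in> carrier_mat n n \<Longrightarrow> mat_trace (c \<cdot>\<^sub>m A) = c * mat_trace A"
  by (simp add: mat_trace_carrier[of _ n] sum_distrib_left)

lemma mat_trace_unitary_conj:
  assumes "unitary_mat n U" "A \<in> carrier_mat n n"
  shows "mat_trace (U * A * mat_adjoint U) = mat_trace A"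
proof -
  note U = unitary_matD[OF assms(1)]
  have "mat_trace (U * A * mat_adjoint U) = mat_trace (mat_adjoint U * (U * A))"
    using U assms(2) by (intro mat_trace_mult_comm[of _ n]) auto
  also have "mat_adjoint U * (U * A) = A"
    using U assms(2) assoc_mult_mat[of "mat_adjoint U" n n U n A n] by simp
  finally show ?thesis .
qed

lemma index_real_diag_mult:
  assumes "A \<in> carrier_mat n n" "i < n" "j < n"
  shows "(real_diag n d * A) $$ (i, j) = of_real (d i) * A $$ (i, j)"
    and "(A * real_diag n d) $$ (i, j) = A $$ (i, j) * of_real (d j)"
  using assms
  by (simp_all add: index_mult_mat_sum[of _ n n _ n] real_diag_def if_distrib[of "\<lambda>x. x * _"]
      if_distrib[of "\<lambda>x. _ * x"] del: index_mult_mat(1) cong: if_cong)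

lemma real_diag_cong:
  "(\<And>i. i < n \<Longrightarrow> d i = e i) \<Longrightarrow> real_diag n d = real_diag n e"
  by (rule eq_matI) (auto simp: real_diag_def)

lemma mat_adjoint_conj:
  fixes A B :: "complex mat"
  assumes A: "A \<in> carrier_mat n n" and B: "B \<in> carrier_mat n n"
  shows "mat_adjoint (mat_adjoint B * A * B) = mat_adjoint B * mat_adjoint A * B"
  using A B by (simp add: mat_adjoint_mult[of _ n n _ n] assoc_mult_mat[of _ n n _ n _ n])

lemma unitary_conj_mult:
  assumes "unitary_mat n U" "A \<in> carrier_mat n n" "B \<in> carrier_mat n n"
  shows "(U * A * mat_adjoint U) * (U * B * mat_adjoint U) = U * (A * B) * mat_adjoint U"
proof -
  note U = unitary_matD[OF assms(1)]
  have "(U * A * mat_adjoint U) * (U * (B * mat_adjoint U)) = (U * A) * (B * mat_adjoint U)"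
    using U assms by (intro mat_mult_cancel_middle) auto
  then show ?thesis
    using U(1) assms by (simp add: assoc_mult_mat[of _ n n _ n _ n])
qed

lemma unitary_conj_eq_iff:
  assumes "unitary_mat n U" "A \<in> carrier_mat n n" "B \<in> carrier_mat n n"
  shows "A = U * B * mat_adjoint U \<longleftrightarrow> B = mat_adjoint U * A * U"
proof -
  note U = unitary_matD[OF assms(1)]
  have cancel: "U * (mat_adjoint U * X) = X" "mat_adjoint U * (U * X) = X" if "X \<in> carrier_mat n n" for X
    using U that assoc_mult_mat[of U n n "mat_adjoint U" n X n] assoc_mult_mat[of "mat_adjoint U" n n U n X n]
    by (simp_all del: assoc_mult_mat)
  show ?thesis
  proof
    show "B = mat_adjoint U * A * U" if "A = U * B * mat_adjoint U"
      unfolding that using U(1,2) assms(3) by (simp add: assoc_mult_mat[of _ n n _ n _ n] cancel)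
    show "A = U * B * mat_adjoint U" if "B = mat_adjoint U * A * U"
      unfolding that using U(1,3) assms(2) by (simp add: assoc_mult_mat[of _ n n _ n _ n] cancel)
  qed
qed

lemma positive_semidefinite_iff:
  assumes "P \<in> carrier_mat n n"
  shows "positive_semidefinite P \<longleftrightarrow>
    mat_adjoint P = P \<and> (\<forall>v \<in> carrier_vec n. Re ((P *\<^sub>v v) \<bullet>c v) \<ge> 0)"
  using assms by (simp add: positive_semidefinite_def carrier_matD)

lemma positive_semidefinite_carrier:
  "positive_semidefinite P \<Longrightarrow> P \<in> carrier_mat (dim_row P) (dim_row P)"
  by (intro carrier_matI) (simp_all only: positive_semidefinite_def square_mat.simps)

text \<open>The quadratic form of the conjugate at v is that of P at B v.\<close>

lemma positive_semidefinite_conj: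
  assumes P: "P \<in> carrier_mat n n" "positive_semidefinite P" and B: "B \<in> carrier_mat n n"
  shows "positive_semidefinite (mat_adjoint B * P * B)"
proof -
  have "Re ((mat_adjoint B * P * B *\<^sub>v v) \<bullet>c v) \<ge> 0" if v: "v \<in> carrier_vec n" for v
  proof -
    have Bv: "B *\<^sub>v v \<in> carrier_vec n"
      using B v by (rule mult_mat_vec_carrier)
    have PBv: "P *\<^sub>v (B *\<^sub>v v) \<in> carrier_vec n"
      using P(1) Bv by (rule mult_mat_vec_carrier)
    have "mat_adjoint B * P * B *\<^sub>v v = mat_adjoint B *\<^sub>v (P *\<^sub>v (B *\<^sub>v v))"
      using P B v Bv by (simp add: assoc_mult_mat_vec[of _ n n _ n] )
    then have "(mat_adjoint B * P * B *\<^sub>v v) \<bullet>c v = (P *\<^sub>v (B *\<^sub>v v)) \<bullet>c (B *\<^sub>v v)"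
      using cscalar_prod_mult_adjoint[OF mat_adjoint_carrier[OF B] PBv v] by simp
    then show ?thesis using P Bv by (simp add: positive_semidefinite_iff)
  qed
  then show ?thesis
    using P B by (simp add: positive_semidefinite_iff[of _ n] mat_adjoint_conj)
qed

lemma positive_semidefinite_real_diag:
  assumes "\<And>i. i < n \<Longrightarrow> d i \<ge> 0"
  shows "positive_semidefinite (real_diag n d)"
proof -
  have "Re ((real_diag n d *\<^sub>v v) \<bullet>c v) \<ge> 0" if v: "v \<in> carrier_vec n" for v
  proof -
    have "(real_diag n d *\<^sub>v v) $ i = of_real (d i) * v $ i" if "i < n" for i
      using that v
      by (simp add: index_mult_mat_vec_sum[of _ n n] real_diag_def if_distrib[of "\<lambda>x. x * _"]
          del: index_mult_mat_vec cong: if_cong)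
    then have "(real_diag n d *\<^sub>v v) \<bullet>c v = (\<Sum>i<n. of_real (d i) * (v $ i * cnj (v $ i)))"
      using v by (subst cscalar_prod_sum[of _ n]) (auto simp: mult.assoc intro!: sum.cong carrier_vecI)
    also have "\<dots> = of_real (\<Sum>i<n. d i * (cmod (v $ i))\<^sup>2)"
      by (simp only: complex_norm_square[symmetric] of_real_mult[symmetric] of_real_sum[symmetric])
    finally have "Re ((real_diag n d *\<^sub>v v) \<bullet>c v) = (\<Sum>i<n. d i * (cmod (v $ i))\<^sup>2)"
      by (simp only: Re_complex_of_real)
    then show ?thesis using assms by (auto intro!: sum_nonneg mult_nonneg_nonneg)
  qed
  then show ?thesis by (simp add: positive_semidefinite_iff[of _ n])
qed

lemma positive_semidefinite_one: "positive_semidefinite (1\<^sub>m n)"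
proof -
  have "real_diag n (\<lambda>_. 1) = 1\<^sub>m n"
    by (rule eq_matI) (auto simp: real_diag_def)
  then show ?thesis
    using positive_semidefinite_real_diag[of n "\<lambda>_. 1"] by simp
qed

lemma positive_semidefinite_gram:
  "A \<in> carrier_mat n n \<Longrightarrow> positive_semidefinite (mat_adjoint A * A)"
  using positive_semidefinite_conj[OF one_carrier_mat positive_semidefinite_one, of A n] by simp

text \<open>A diagonal entry is the value of the quadratic form at a standard basis vector.\<close>

lemma positive_semidefinite_diag:
  assumes P: "P \<in> carrier_mat n n" "positive_semidefinite P" and i: "i < n"
  shows "Re (P $$ (i, i)) \<ge> 0"
proof -
  have "(P *\<^sub>v unit_vec n i) \<bullet>c unit_vec n i = P $$ (i, i)"
  proof (subst cscalar_prod_sum[of _ n])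
    have "(P *\<^sub>v unit_vec n i) $ k * cnj (unit_vec n i $ k) = (if k = i then P $$ (i, i) else 0)"
      if "k < n" for k using that P i by (simp add: scalar_prod_right_unit)
    then show "(\<Sum>k<n. (P *\<^sub>v unit_vec n i) $ k * cnj (unit_vec n i $ k)) = P $$ (i, i)"
      using i by (simp del: index_mult_mat_vec)
  qed (use P in \<open>auto intro: carrier_vecI\<close>)
  then show ?thesis
    using P i by (metis positive_semidefinite_iff unit_vec_carrier)
qed

lemma positive_semidefinite_diagonalizable:
  assumes P: "P \<in> carrier_mat n n" "positive_semidefinite P"
  obtains U d where "unitary_mat n U" "\<And>i. i < n \<Longrightarrow> d i \<ge> 0" "P = U * real_diag n d * mat_adjoint U"
proof -
  have "mat_adjoint P = P" using P by (simp add: positive_semidefinite_iff)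
  then obtain U d where U: "unitary_mat n U" and eq: "P = U * real_diag n d * mat_adjoint U"
    using hermitian_diagonalizable[OF P(1)] by blast
  have "real_diag n d = mat_adjoint U * P * U"
    using eq unitary_conj_eq_iff[OF U P(1), of "real_diag n d"] by simp
  then have "positive_semidefinite (real_diag n d)"
    using positive_semidefinite_conj[OF P unitary_matD(1)[OF U]] by simp
  then have "d i \<ge> 0" if "i < n" for i
    using positive_semidefinite_diag[OF real_diag_carrier, of n d i] that by (simp add: real_diag_def)
  with U eq show ?thesis using that by blast
qed

lemma positive_semidefinite_unitary_conj:
  assumes "unitary_mat n U" "P \<in> carrier_mat n n" "positive_semidefinite P"
  shows "positive_semidefinite (U * P * mat_adjoint U)"
  using positive_semidefinite_conj[OF assms(2,3), of "mat_adjoint U"] unitary_matD[OF assms(1)] by simp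

section \<open>Existence and uniqueness of the positive square root\<close>

lemma positive_semidefinite_sqrt_exists:
  assumes P: "P \<in> carrier_mat n n" "positive_semidefinite P"
  shows "\<exists>S. positive_semidefinite S \<and> S * S = P"
proof -
  obtain U d where U: "unitary_mat n U" and d: "\<And>i. i < n \<Longrightarrow> d i \<ge> 0"
    and eq: "P = U * real_diag n d * mat_adjoint U"
    using positive_semidefinite_diagonalizable[OF P] by blast
  let ?D = "real_diag n (\<lambda>i. sqrt (d i))"
  have "?D * ?D = real_diag n d"
    using d by (auto simp: real_diag_mult intro: real_diag_cong)
  then have "(U * ?D * mat_adjoint U) * (U * ?D * mat_adjoint U) = P"
    by (simp add: unitary_conj_mult[OF U] eq)
  moreover have "positive_semidefinite (U * ?D * mat_adjoint U)"
    using d by (intro positive_semidefinite_unitary_conj[OF U] positive_semidefinite_real_diag) auto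
  ultimately show ?thesis by blast
qed

text \<open>In an eigenbasis of \<open>S - T\<close> with eigenvalues \<open>d\<close>, the diagonal of \<open>S (S - T) + (S - T) T = 0\<close>
  says that the nonnegative diagonal entries \<open>s\<close>, \<open>t\<close> of S and T satisfy \<open>d (s + t) = 0\<close>,
  while \<open>d = s - t\<close>.\<close>

lemma positive_semidefinite_sqrt_unique:
  assumes S: "positive_semidefinite S" and T: "positive_semidefinite T" and eq: "S * S = T * T"
  shows "S = T"
proof -
  define n where "n = dim_row S"
  \<comment> \<open>Matrices of every size compete in the definite description; the equation of the
    squares forces equal sizes.\<close>
  have car: "S \<in> carrier_mat n n" "T \<in> carrier_mat n n"
    using positive_semidefinite_carrier[OF S] positive_semidefinite_carrier[OF T]
      arg_cong[OF eq, of dim_row, unfolded index_mult_mat] by (simp_all only: n_def)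
  have "mat_adjoint (S - T) = S - T"
    using S T car by (simp add: mat_adjoint_minus[of _ n n] positive_semidefinite_iff)
  then obtain U d where U: "unitary_mat n U" and ST: "S - T = U * real_diag n d * mat_adjoint U"
    using hermitian_diagonalizable[OF minus_carrier_mat[OF car(2)]] by blast
  note U' = unitary_matD[OF U]
  define S' T' where "S' = mat_adjoint U * S * U" and "T' = mat_adjoint U * T * U"
  have car': "S' \<in> carrier_mat n n" "T' \<in> carrier_mat n n"
    using U' car by (simp_all add: S'_def T'_def)
  have psd': "positive_semidefinite S'" "positive_semidefinite T'"
    using S T car U' by (auto simp: S'_def T'_def intro!: positive_semidefinite_conj)
  have eq': "S' * S' = T' * T'"
    using unitary_conj_mult[OF unitary_mat_adjoint[OF U], of S S]
      unitary_conj_mult[OF unitary_mat_adjoint[OF U], of T T] car eq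
    by (simp add: S'_def T'_def)
  have "real_diag n d = mat_adjoint U * (S - T) * U"
    using unitary_conj_eq_iff[OF U minus_carrier_mat[OF car(2)] real_diag_carrier] ST by blast
  also have "\<dots> = S' - T'"
    using U' car by (simp add: S'_def T'_def mult_minus_distrib_mat[of _ n n _ n]
        minus_mult_distrib_mat[of _ n n _ _ n])
  finally have D: "real_diag n d = S' - T'" .
  have "S' * (S' - T') + (S' - T') * T' = (S' * S' - S' * T') + (S' * T' - T' * T')"
    using car' by (simp add: mult_minus_distrib_mat[of _ n n _ n] minus_mult_distrib_mat[of _ n n _ _ n])
  also have "\<dots> = 0\<^sub>m n n"
    using car' by (intro eq_matI) (simp_all add: eq' del: index_mult_mat(1))
  finally have zero: "S' * real_diag n d + real_diag n d * T' = 0\<^sub>m n n" by (simp add: D)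
  have d0: "d i = 0" if i: "i < n" for i
  proof -
    have "S' $$ (i, i) * of_real (d i) + of_real (d i) * T' $$ (i, i) = 0"
      using arg_cong[OF zero, of "\<lambda>X. X $$ (i, i)"] i car'
      by (simp add: index_real_diag_mult[of _ n] del: index_mult_mat(1))
    then have "d i * (Re (S' $$ (i, i)) + Re (T' $$ (i, i))) = 0"
      by (simp add: complex_eq_iff algebra_simps)
    moreover have "Re (S' $$ (i, i)) \<ge> 0" "Re (T' $$ (i, i)) \<ge> 0"
      using positive_semidefinite_diag car' psd' i by blast+
    moreover have "d i = Re (S' $$ (i, i)) - Re (T' $$ (i, i))"
      using arg_cong[OF D, of "\<lambda>X. Re (X $$ (i, i))"] i car' by (simp add: real_diag_def)
    \<comment> \<open>If \<open>d i\<close> were nonzero, two nonnegative numbers would add up to 0,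
      so both would vanish, and with them their difference \<open>d i\<close>.\<close>
    ultimately show ?thesis by auto
  qed
  have "real_diag n d = 0\<^sub>m n n"
    by (rule eq_matI) (auto simp: real_diag_def d0)
  then have "S - T = 0\<^sub>m n n"
    using ST U' by simp
  then show ?thesis
    using car by (metis carrier_matD(1,2) eq_matI index_minus_mat(1) index_zero_mat(1) right_minus_eq)
qed

lemma mat_sqrt:
  assumes "P \<in> carrier_mat n n" "positive_semidefinite P"
  shows "positive_semidefinite (mat_sqrt P)" "mat_sqrt P * mat_sqrt P = P" "mat_sqrt P \<in> carrier_mat n n"
proof -
  have "\<exists>!S. positive_semidefinite S \<and> S * S = P"
    using positive_semidefinite_sqrt_exists[OF assms] positive_semidefinite_sqrt_unique by auto
  from theI'[OF this] show *: "positive_semidefinite (mat_sqrt P)" "mat_sqrt P * mat_sqrt P = P"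
    by (simp_all add: mat_sqrt_def)
  show "mat_sqrt P \<in> carrier_mat n n"
    using positive_semidefinite_carrier[OF *(1)] arg_cong[OF *(2), of dim_row, unfolded index_mult_mat]
      carrier_matD(1)[OF assms(1)] by (simp only:)
qed

lemma mat_abs:
  assumes "A \<in> carrier_mat n n"
  shows "positive_semidefinite (mat_abs A)" "mat_abs A * mat_abs A = mat_adjoint A * A"
    "mat_abs A \<in> carrier_mat n n"
  unfolding mat_abs_def using assms by (auto intro!: mat_sqrt positive_semidefinite_gram)

subsection \<open>The trace norm\<close>

definition trace_norm :: "complex mat \<Rightarrow> real" where
  "trace_norm A = Re (mat_trace (mat_abs A))"

text \<open>Operator norm at most 1, expressed through positivity. The product has W on the left
  because its diagonal entries are then the squared lengths of the rows of W, which is what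
  Cauchy-Schwarz meets in the trace of W A.\<close>

definition contraction_mat :: "nat \<Rightarrow> complex mat \<Rightarrow> bool" where
  "contraction_mat n W \<longleftrightarrow>
     W \<in> carrier_mat n n \<and> positive_semidefinite (1\<^sub>m n - W * mat_adjoint W)"

lemma contraction_mat_carrier: "contraction_mat n W \<Longrightarrow> W \<in> carrier_mat n n"
  by (simp add: contraction_mat_def)

lemma contraction_mat_unitary_mult:
  assumes U: "unitary_mat n U" and W: "contraction_mat n W"
  shows "contraction_mat n (mat_adjoint U * W)"
proof -
  note U' = unitary_matD[OF U] and W' = contraction_mat_carrier[OF W]
  have "1\<^sub>m n - (mat_adjoint U * W) * mat_adjoint (mat_adjoint U * W)
      = mat_adjoint U * 1\<^sub>m n * U - mat_adjoint U * (W * mat_adjoint W) * U"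
    using U' W' by (simp add: mat_adjoint_mult[of _ n n _ n] assoc_mult_mat[of _ n n _ n _ n])
  also have "\<dots> = mat_adjoint U * (1\<^sub>m n - W * mat_adjoint W) * U"
    using U' W' by (simp add: mult_minus_distrib_mat[of _ n n _ n] minus_mult_distrib_mat[of _ n n _ _ n])
  finally show ?thesis
    using W U' W' positive_semidefinite_conj[of "1\<^sub>m n - W * mat_adjoint W" n U]
    by (simp add: contraction_mat_def minus_carrier_mat)
qed

lemma contraction_mat_mult_unitary:
  assumes U: "unitary_mat n U" and W: "contraction_mat n W"
  shows "contraction_mat n (W * U)"
proof -
  note U' = unitary_matD[OF U] and W' = contraction_mat_carrier[OF W]
  have "(W * U) * (mat_adjoint U * mat_adjoint W) = W * mat_adjoint W"
    using U' W' by (intro mat_mult_cancel_middle) auto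
  then show ?thesis
    using W U' W' by (simp add: contraction_mat_def mat_adjoint_mult[of _ n n _ n])
qed

lemma contraction_mat_row:
  assumes W: "contraction_mat n W" and i: "i < n"
  shows "(\<Sum>k<n. (cmod (W $$ (i, k)))\<^sup>2) \<le> 1"
proof -
  note W' = contraction_mat_carrier[OF W]
  have "(W * mat_adjoint W) $$ (i, i) = (\<Sum>k<n. W $$ (i, k) * mat_adjoint W $$ (k, i))"
    using W' i by (intro index_mult_mat_sum) auto
  also have "\<dots> = of_real (\<Sum>k<n. (cmod (W $$ (i, k)))\<^sup>2)"
    using W' i by (simp add: complex_norm_square del: of_real_power)
  finally have eq: "(W * mat_adjoint W) $$ (i, i) = of_real (\<Sum>k<n. (cmod (W $$ (i, k)))\<^sup>2)" .
  have "0 \<le> Re ((1\<^sub>m n - W * mat_adjoint W) $$ (i, i))"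
    using W W' i by (intro positive_semidefinite_diag[of _ n]) (auto simp: contraction_mat_def minus_carrier_mat)
  also have "(1\<^sub>m n - W * mat_adjoint W) $$ (i, i) = 1 - (W * mat_adjoint W) $$ (i, i)"
    using W' i by (simp del: index_mult_mat(1))
  finally show ?thesis unfolding eq by simp
qed

text \<open>The numbers s are the singular values of A, and the columns of U are the right singular
  vectors.\<close>

lemma trace_norm_spectral:
  assumes A: "A \<in> carrier_mat n n"
  obtains U s where "unitary_mat n U" "\<And>i. i < n \<Longrightarrow> s i \<ge> 0"
    "mat_abs A = U * real_diag n s * mat_adjoint U"
    "mat_adjoint A * A = U * real_diag n (\<lambda>i. s i * s i) * mat_adjoint U"
    "trace_norm A = (\<Sum>i<n. s i)"
proof -
  note S = mat_abs[OF A]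
  obtain U s where U: "unitary_mat n U" and s: "\<And>i. i < n \<Longrightarrow> s i \<ge> 0"
    and eq: "mat_abs A = U * real_diag n s * mat_adjoint U"
    using positive_semidefinite_diagonalizable[OF S(3,1)] by blast
  have "mat_adjoint A * A = U * real_diag n (\<lambda>i. s i * s i) * mat_adjoint U"
    using unitary_conj_mult[OF U real_diag_carrier real_diag_carrier, of s s] S(2)
    by (simp only: eq real_diag_mult)
  moreover have "trace_norm A = (\<Sum>i<n. s i)"
    using mat_trace_unitary_conj[OF U real_diag_carrier, of s]
    by (simp add: trace_norm_def eq mat_trace_carrier[of _ n] real_diag_def)
  ultimately show ?thesis using U s eq that by blast
qed

text \<open>In an eigenbasis U of |A|, the i-th column of A U has length \<open>s i\<close>, while
  the rows of \<open>mat_adjoint U * W\<close> have length at most 1. Cauchy-Schwarz bounds the i-th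
  diagonal entry of the product by \<open>s i\<close>, and these sum to the trace norm.\<close>

lemma trace_norm_bound:
  assumes A: "A \<in> carrier_mat n n" and W: "contraction_mat n W"
  shows "Re (mat_trace (W * A)) \<le> trace_norm A"
proof -
  obtain U s where U: "unitary_mat n U" and s: "\<And>i. i < n \<Longrightarrow> s i \<ge> 0"
    and gram: "mat_adjoint A * A = U * real_diag n (\<lambda>i. s i * s i) * mat_adjoint U"
    and norm: "trace_norm A = (\<Sum>i<n. s i)"
    using trace_norm_spectral[OF A] by blast
  note U' = unitary_matD[OF U] and W' = contraction_mat_carrier[OF W]
  define X Z where "X = A * U" and "Z = mat_adjoint U * W"
  have X: "X \<in> carrier_mat n n" using A U' by (simp add: X_def)
  have Z: "contraction_mat n Z" using contraction_mat_unitary_mult[OF U W] by (simp add: Z_def)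
  note Z' = contraction_mat_carrier[OF Z]
  \<comment> \<open>\<open>Z * X\<close> is the conjugate of \<open>W * A\<close> by U, which has
    the same trace.\<close>
  have tr: "mat_trace (W * A) = mat_trace (Z * X)"
    using mat_trace_unitary_conj[OF unitary_mat_adjoint[OF U], of "W * A"] U' W' A
    by (simp add: X_def Z_def assoc_mult_mat[of _ n n _ n _ n])
  have "real_diag n (\<lambda>i. s i * s i) = mat_adjoint U * (mat_adjoint A * A) * U"
    using unitary_conj_eq_iff[OF U _ real_diag_carrier] gram A by (metis mat_adjoint_carrier mult_carrier_mat)
  also have "\<dots> = mat_adjoint X * X"
    using A U' by (simp add: X_def mat_adjoint_mult[of _ n n _ n] assoc_mult_mat[of _ n n _ n _ n])
  finally have gramX: "mat_adjoint X * X = real_diag n (\<lambda>i. s i * s i)" ..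
  have col: "(\<Sum>k<n. (cmod (X $$ (k, i)))\<^sup>2) = (s i)\<^sup>2" if i: "i < n" for i
  proof -
    have "complex_of_real ((s i)\<^sup>2) = (mat_adjoint X * X) $$ (i, i)"
      using i by (simp add: gramX real_diag_def power2_eq_square)
    also have "\<dots> = (\<Sum>k<n. mat_adjoint X $$ (i, k) * X $$ (k, i))"
      using X i by (intro index_mult_mat_sum) auto
    also have "\<dots> = of_real (\<Sum>k<n. (cmod (X $$ (k, i)))\<^sup>2)"
      using X i by (simp add: complex_norm_square mult.commute del: of_real_power)
    finally show ?thesis by (simp only: of_real_eq_iff)
  qed
  have "Re ((Z * X) $$ (i, i)) \<le> s i" if i: "i < n" for i
  proof -
    have "Re ((Z * X) $$ (i, i)) \<le> cmod (\<Sum>k<n. Z $$ (i, k) * X $$ (k, i))"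
      using complex_Re_le_cmod by (simp only: index_mult_mat_sum[OF Z' X i i])
    also have "\<dots> \<le> (\<Sum>k<n. \<bar>cmod (Z $$ (i, k))\<bar> * \<bar>cmod (X $$ (k, i))\<bar>)"
      by (rule order_trans[OF norm_sum]) (simp add: norm_mult)
    also have "\<dots> \<le> L2_set (\<lambda>k. cmod (Z $$ (i, k))) {..<n} * L2_set (\<lambda>k. cmod (X $$ (k, i))) {..<n}"
      by (rule L2_set_mult_ineq)
    also have "\<dots> \<le> 1 * s i"
      using contraction_mat_row[OF Z i] col[OF i] s[OF i]
      by (intro mult_mono) (auto simp: L2_set_def real_sqrt_le_1_iff)
    finally show ?thesis by simp
  qed
  then have "(\<Sum>i<n. Re ((Z * X) $$ (i, i))) \<le> (\<Sum>i<n. s i)"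
    by (intro sum_mono) auto
  then show ?thesis
    by (simp only: tr norm mat_trace_carrier[OF mult_carrier_square_mat[OF Z' X]] Re_sum)
qed

text \<open>The witness is the adjoint of the partial isometry in the polar decomposition of A,
  written as the pseudoinverse of |A| times the adjoint of A. It sends A to |A|, and W times its
  adjoint is the orthogonal projection onto the range of |A|, hence at most 1.\<close>

lemma trace_norm_attained:
  assumes A: "A \<in> carrier_mat n n"
  obtains W where "contraction_mat n W" "Re (mat_trace (W * A)) = trace_norm A"
proof -
  obtain U s where U: "unitary_mat n U" and s: "\<And>i. i < n \<Longrightarrow> s i \<ge> 0"
    and abs: "mat_abs A = U * real_diag n s * mat_adjoint U"
    and gram: "mat_adjoint A * A = U * real_diag n (\<lambda>i. s i * s i) * mat_adjoint U"
    using trace_norm_spectral[OF A] by blast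
  note U' = unitary_matD[OF U]
  \<comment> \<open>As \<open>inverse 0 = 0\<close>, F is the pseudoinverse of \<open>|A|\<close>.\<close>
  define F where "F = U * real_diag n (\<lambda>i. inverse (s i)) * mat_adjoint U"
  have F: "F \<in> carrier_mat n n" using U' by (simp add: F_def)
  have hermF: "mat_adjoint F = F"
    using mat_adjoint_conj[of "real_diag n (\<lambda>i. inverse (s i))" n "mat_adjoint U"] U' by (simp add: F_def)
  define W where "W = F * mat_adjoint A"
  have W: "W \<in> carrier_mat n n" using F A by (simp add: W_def)
  have "W * A = F * (mat_adjoint A * A)"
    using F A by (simp add: W_def assoc_mult_mat[of _ n n _ n _ n])
  also have "\<dots> = U * real_diag n (\<lambda>i. inverse (s i) * (s i * s i)) * mat_adjoint U"
    unfolding gram F_def by (simp only: unitary_conj_mult[OF U real_diag_carrier real_diag_carrier] real_diag_mult)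
  also have "real_diag n (\<lambda>i. inverse (s i) * (s i * s i)) = real_diag n s"
    by (rule real_diag_cong) (simp add: field_simps)
  finally have "W * A = mat_abs A" using abs by simp
  moreover have "contraction_mat n W"
  proof -
    \<comment> \<open>The value is 1 where \<open>s i\<close> is nonzero and 0 elsewhere: the
      eigenvalues of that projection.\<close>
    let ?p = "\<lambda>i. inverse (s i) * (s i * s i) * inverse (s i)"
    have "W * mat_adjoint W = F * (mat_adjoint A * A) * F"
      using F A hermF by (simp add: W_def mat_adjoint_mult[of _ n n _ n] assoc_mult_mat[of _ n n _ n _ n])
    also have "\<dots> = U * real_diag n ?p * mat_adjoint U"
      unfolding gram F_def by (simp only: unitary_conj_mult[OF U] real_diag_carrier real_diag_mult)
    finally have "1\<^sub>m n - W * mat_adjoint W = U * 1\<^sub>m n * mat_adjoint U - U * real_diag n ?p * mat_adjoint U"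
      using U' by simp
    also have "\<dots> = U * (1\<^sub>m n - real_diag n ?p) * mat_adjoint U"
      using U' by (simp add: mult_minus_distrib_mat[of _ n n _ n] minus_mult_distrib_mat[of _ n n _ _ n])
    also have "1\<^sub>m n - real_diag n ?p = real_diag n (\<lambda>i. 1 - ?p i)"
      by (rule eq_matI) (auto simp: real_diag_def)
    finally have "1\<^sub>m n - W * mat_adjoint W = U * real_diag n (\<lambda>i. 1 - ?p i) * mat_adjoint U" .
    moreover have "positive_semidefinite (real_diag n (\<lambda>i. 1 - ?p i))"
      by (rule positive_semidefinite_real_diag) (simp add: field_simps)
    ultimately show ?thesis
      using W positive_semidefinite_unitary_conj[OF U] by (simp add: contraction_mat_def)
  qed
  ultimately show ?thesis using that by (simp add: trace_norm_def)
qed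

text \<open>The contraction attaining the norm of the sum is admissible for each summand, and the
  pairing is linear.\<close>

lemma trace_norm_triangle:
  assumes A: "A \<in> carrier_mat n n" and B: "B \<in> carrier_mat n n"
  shows "trace_norm (A + B) \<le> trace_norm A + trace_norm B"
proof -
  obtain W where W: "contraction_mat n W" and eq: "Re (mat_trace (W * (A + B))) = trace_norm (A + B)"
    using trace_norm_attained[of "A + B" n] A B by auto
  note W' = contraction_mat_carrier[OF W]
  have "mat_trace (W * (A + B)) = mat_trace (W * A) + mat_trace (W * B)"
    using W' A B by (simp add: mult_add_distrib_mat[of _ n n _ n] mat_trace_add[of _ n])
  then show ?thesis
    using eq trace_norm_bound[OF A W] trace_norm_bound[OF B W] by simp
qed

text \<open>Pairing the conjugate of A with W equals pairing A with W conjugated the other way,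
  which is again a contraction; so both halves of the average are bounded by the norm of A.\<close>

lemma trace_norm_unitary_average:
  assumes A: "A \<in> carrier_mat n n" and U: "unitary_mat n U"
  shows "trace_norm ((1 / 2) \<cdot>\<^sub>m (A + U * A * mat_adjoint U)) \<le> trace_norm A"
proof -
  note U' = unitary_matD[OF U]
  let ?B = "U * A * mat_adjoint U"
  have B: "?B \<in> carrier_mat n n" using A U' by simp
  obtain W where W: "contraction_mat n W"
    and eq: "Re (mat_trace (W * ((1 / 2) \<cdot>\<^sub>m (A + ?B)))) = trace_norm ((1 / 2) \<cdot>\<^sub>m (A + ?B))"
    using trace_norm_attained[of "(1 / 2) \<cdot>\<^sub>m (A + ?B)" n] A B by auto
  note W' = contraction_mat_carrier[OF W]
  have "mat_trace (W * ((1 / 2) \<cdot>\<^sub>m (A + ?B))) = mat_trace ((1 / 2) \<cdot>\<^sub>m (W * A + W * ?B))"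
    using W' A B by (simp add: mult_smult_distrib[of _ n n _ n] mult_add_distrib_mat[of _ n n _ n])
  also have "\<dots> = (mat_trace (W * A) + mat_trace (W * ?B)) / 2"
    using W' A B by (simp add: mat_trace_smult[of _ n] mat_trace_add[of _ n] del: assoc_mult_mat)
  also have "mat_trace (W * ?B) = mat_trace (mat_adjoint U * (W * U) * A)"
    using mat_trace_unitary_conj[OF unitary_mat_adjoint[OF U], of "W * ?B"] W' A U'
    by (simp add: assoc_mult_mat[of _ n n _ n _ n])
  finally have "Re (mat_trace (W * ((1 / 2) \<cdot>\<^sub>m (A + ?B)))) =
      (Re (mat_trace (W * A)) + Re (mat_trace (mat_adjoint U * (W * U) * A))) / 2"
    by (simp only: Re_divide_numeral plus_complex.sel)
  moreover have "contraction_mat n (mat_adjoint U * (W * U))"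
    by (intro contraction_mat_unitary_mult contraction_mat_mult_unitary U W)
  ultimately show ?thesis
    using eq trace_norm_bound[OF A W] trace_norm_bound[OF A, of "mat_adjoint U * (W * U)"] by simp
qed

text \<open>Read off from the attained pairing, which avoids computing the square root of the zero
  matrix.\<close>

lemma trace_norm_zero: "trace_norm (0\<^sub>m n n) = 0"
proof -
  obtain W where "contraction_mat n W" "Re (mat_trace (W * 0\<^sub>m n n)) = trace_norm (0\<^sub>m n n)"
    using trace_norm_attained[of "0\<^sub>m n n" n] by auto
  moreover have "W * 0\<^sub>m n n = 0\<^sub>m n n"
    using contraction_mat_carrier[OF calculation(1)] by simp
  ultimately show ?thesis by (simp add: mat_trace_def)
qed

subsection \<open>Averaging over bits\<close>

unbundle bit_operations_syntax

lemma xor_less_power: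
  fixes x y :: nat
  assumes "x < 2 ^ n" "y < 2 ^ n"
  shows "x XOR y < 2 ^ n"
  using assms by (simp flip: take_bit_nat_eq_self_iff)

lemma xor_power_less:
  fixes x :: nat
  shows "x < 2 ^ n \<Longrightarrow> k < n \<Longrightarrow> x XOR 2 ^ k < 2 ^ n"
  by (rule xor_less_power) auto

lemma xor_xor_right_nat [simp]: "(x XOR y) XOR y = (x :: nat)"
  by (simp add: xor.assoc)

lemma bit_power_nat: "bit (2 ^ k :: nat) j \<longleftrightarrow> j = k"
  by (simp add: bit_exp_iff)

lemma bit_xor_power: "bit (x XOR 2 ^ k :: nat) j \<longleftrightarrow> (if j = k then \<not> bit x j else bit x j)"
  by (auto simp: bit_xor_iff bit_power_nat)

text \<open>The conditional expectation of the overview in matrix entries, for the qubit stored in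
  bit k. Bits count from the least significant digit, so qubit j of n is bit \<open>n - j\<close>,
  and XOR with \<open>2 ^ k\<close> flips that qubit.\<close>

definition bit_avg :: "nat \<Rightarrow> complex mat \<Rightarrow> complex mat" where
  "bit_avg k A = mat (dim_row A) (dim_col A) (\<lambda>(x, y).
     if bit x k = bit y k then (A $$ (x, y) + A $$ (x XOR 2 ^ k, y XOR 2 ^ k)) / 2 else 0)"

lemma bit_avg_carrier: "A \<in> carrier_mat m n \<Longrightarrow> bit_avg k A \<in> carrier_mat m n"
  by (simp add: bit_avg_def carrier_matD)

lemma index_bit_avg:
  assumes "A \<in> carrier_mat m n" "x < m" "y < n"
  shows "bit_avg k A $$ (x, y) =
    (if bit x k = bit y k then (A $$ (x, y) + A $$ (x XOR 2 ^ k, y XOR 2 ^ k)) / 2 else 0)"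
  using assms by (simp add: bit_avg_def)

lemma bit_avg_minus:
  assumes A: "A \<in> carrier_mat (2 ^ n) (2 ^ n)" and B: "B \<in> carrier_mat (2 ^ n) (2 ^ n)" and k: "k < n"
  shows "bit_avg k (A - B) = bit_avg k A - bit_avg k B"
  using A B k
  by (intro eq_matI)
    (auto simp: bit_avg_def minus_carrier_mat xor_power_less diff_divide_distrib add_divide_distrib)

text \<open>Averaging over the Pauli matrix Z kills the entries whose row and column disagree
  in the given bit, and averaging over X then identifies the two diagonal blocks.\<close>

lemma trace_norm_bit_avg:
  assumes A: "A \<in> carrier_mat (2 ^ n) (2 ^ n)" and k: "k < n"
  shows "trace_norm (bit_avg k A) \<le> trace_norm A"
proof -
  let ?N = "2 ^ n :: nat"
  \<comment> \<open>\<open>Z\<close> and \<open>X\<close> are the Pauli matrices acting on bit k and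
    trivially on the others; \<open>X\<close> is the permutation matrix of the bit flip.\<close>
  define Z where "Z = real_diag ?N (\<lambda>x. if bit x k then - 1 else 1)"
  define X where "X = mat ?N ?N (\<lambda>(x, y). if x = y XOR 2 ^ k then 1 else 0 :: complex)"
  have swap: "x = y XOR 2 ^ k \<longleftrightarrow> y = x XOR 2 ^ k" for x y :: nat
    by (metis xor_xor_right_nat)
  have Z: "Z \<in> carrier_mat ?N ?N" and X: "X \<in> carrier_mat ?N ?N"
    by (simp_all add: Z_def X_def)
  have adjZ: "mat_adjoint Z = Z" by (simp add: Z_def)
  have adjX: "mat_adjoint X = X"
    using X swap by (intro eq_matI) (auto simp: X_def)
  have XM: "(X * M) $$ (x, y) = M $$ (x XOR 2 ^ k, y)"
    if "M \<in> carrier_mat ?N ?N" "x < ?N" "y < ?N" for M x y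
  proof -
    have "(X * M) $$ (x, y) = (\<Sum>z<?N. X $$ (x, z) * M $$ (z, y))"
      using that by (intro index_mult_mat_sum[OF X])
    also have "\<dots> = (\<Sum>z<?N. if z = x XOR 2 ^ k then M $$ (z, y) else 0)"
      using that swap[of x] by (intro sum.cong) (auto simp: X_def)
    finally show ?thesis using xor_power_less[OF that(2) k] by (simp del: index_mult_mat(1))
  qed
  have MX: "(M * X) $$ (x, y) = M $$ (x, y XOR 2 ^ k)"
    if "M \<in> carrier_mat ?N ?N" "x < ?N" "y < ?N" for M x y
  proof -
    have "(M * X) $$ (x, y) = (\<Sum>z<?N. M $$ (x, z) * X $$ (z, y))"
      using that by (intro index_mult_mat_sum[OF _ X])
    also have "\<dots> = (\<Sum>z<?N. if z = y XOR 2 ^ k then M $$ (x, z) else 0)"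
      using that by (intro sum.cong) (auto simp: X_def)
    finally show ?thesis using xor_power_less[OF that(3) k] by (simp del: index_mult_mat(1))
  qed
  have "Z * Z = 1\<^sub>m ?N"
    unfolding Z_def real_diag_mult by (rule eq_matI) (auto simp: real_diag_def)
  then have unitZ: "unitary_mat ?N Z" using Z by (simp add: unitary_mat_def adjZ)
  have "X * X = 1\<^sub>m ?N"
  proof (rule eq_matI)
    fix i j assume "i < dim_row (1\<^sub>m ?N :: complex mat)" "j < dim_col (1\<^sub>m ?N :: complex mat)"
    then have ij: "i < ?N" "j < ?N" by auto
    have "(X * X) $$ (i, j) = (if i XOR 2 ^ k = j XOR 2 ^ k then 1 else 0)"
      unfolding XM[OF X ij] using ij xor_power_less[OF ij(1) k] by (simp add: X_def)
    also have "\<dots> = 1\<^sub>m ?N $$ (i, j)"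
      using ij by simp (metis xor_xor_right_nat)
    finally show "(X * X) $$ (i, j) = 1\<^sub>m ?N $$ (i, j)" .
  qed (use X in auto)
  then have unitX: "unitary_mat ?N X" using X by (simp add: unitary_mat_def adjX)
  define B where "B = (1 / 2) \<cdot>\<^sub>m (A + Z * A * mat_adjoint Z)"
  have B: "B \<in> carrier_mat ?N ?N" using A Z by (simp add: B_def)
  \<comment> \<open>Conjugation by \<open>Z\<close> changes the sign of an entry exactly when its
    two indices differ in bit k, so the average cancels it.\<close>
  have entryB: "B $$ (x, y) = (if bit x k = bit y k then A $$ (x, y) else 0)"
    if "x < ?N" "y < ?N" for x y
  proof -
    have ZA: "Z * A \<in> carrier_mat ?N ?N" using A Z by simp
    have "(Z * A * Z) $$ (x, y) = (if bit x k then - 1 else 1) * A $$ (x, y) * (if bit y k then - 1 else 1)"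
      using that index_real_diag_mult(1)[OF A that] index_real_diag_mult(2)[OF ZA that]
      by (simp add: Z_def del: index_mult_mat(1))
    then show ?thesis
      using that A Z by (simp add: B_def adjZ del: index_mult_mat(1))
  qed
  have "bit_avg k A = (1 / 2) \<cdot>\<^sub>m (B + X * B * mat_adjoint X)" (is "_ = ?R")
  proof (rule eq_matI)
    show "dim_row (bit_avg k A) = dim_row ?R" "dim_col (bit_avg k A) = dim_col ?R"
      using A X by (simp_all add: bit_avg_def adjX)
    fix x y assume "x < dim_row ?R" "y < dim_col ?R"
    then have xy: "x < ?N" "y < ?N" using X by (simp_all add: adjX)
    note xy' = xor_power_less[OF xy(1) k] xor_power_less[OF xy(2) k]
    have "(X * B * X) $$ (x, y) = B $$ (x XOR 2 ^ k, y XOR 2 ^ k)"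
      using X B xy xy' by (simp add: MX[of "X * B"] XM[of B] del: index_mult_mat(1) assoc_mult_mat)
    then have "?R $$ (x, y) = (B $$ (x, y) + B $$ (x XOR 2 ^ k, y XOR 2 ^ k)) / 2"
      using X B xy by (simp add: adjX del: index_mult_mat(1) assoc_mult_mat)
    then show "bit_avg k A $$ (x, y) = ?R $$ (x, y)"
      using xy xy' by (simp only: index_bit_avg[OF A xy] entryB bit_xor_power) auto
  qed
  then have "trace_norm (bit_avg k A) \<le> trace_norm B"
    using trace_norm_unitary_average[OF B unitX] by simp
  also have "\<dots> \<le> trace_norm A"
    unfolding B_def by (rule trace_norm_unitary_average[OF A unitZ])
  finally show ?thesis .
qed

text \<open>The highest of the m bits is averaged first. Passing from m to \<open>Suc m\<close> thus
  inserts the new average next to A, and each telescoping difference is an average of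
  \<open>A - bit_avg m A\<close>; commutation of the averages is never invoked.\<close>

primrec low_bits_avg :: "nat \<Rightarrow> complex mat \<Rightarrow> complex mat" where
  "low_bits_avg 0 A = A"
| "low_bits_avg (Suc m) A = low_bits_avg m (bit_avg m A)"

lemma low_bits_avg_carrier:
  "A \<in> carrier_mat l n \<Longrightarrow> low_bits_avg m A \<in> carrier_mat l n"
  by (induction m arbitrary: A) (auto intro: bit_avg_carrier)

lemma low_bits_avg_minus:
  assumes "A \<in> carrier_mat (2 ^ n) (2 ^ n)" "B \<in> carrier_mat (2 ^ n) (2 ^ n)" "m \<le> n"
  shows "low_bits_avg m (A - B) = low_bits_avg m A - low_bits_avg m B"
  using assms by (induction m arbitrary: A B) (simp_all add: bit_avg_minus bit_avg_carrier)

lemma trace_norm_low_bits_avg: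
  assumes "A \<in> carrier_mat (2 ^ n) (2 ^ n)" "m \<le> n"
  shows "trace_norm (low_bits_avg m A) \<le> trace_norm A"
  using assms
proof (induction m arbitrary: A)
  case (Suc m)
  then have "trace_norm (low_bits_avg m (bit_avg m A)) \<le> trace_norm (bit_avg m A)"
    by (simp add: bit_avg_carrier)
  also have "\<dots> \<le> trace_norm A" using Suc.prems by (intro trace_norm_bit_avg) auto
  finally show ?case by simp
qed simp

lemma take_bit_Suc_eq_iff:
  fixes x y :: nat
  shows "take_bit (Suc m) x = take_bit (Suc m) y \<longleftrightarrow> take_bit m x = take_bit m y \<and> bit x m = bit y m"
  unfolding bit_eq_iff[of "take_bit (Suc m) x"] bit_eq_iff[of "take_bit m x"] bit_take_bit_iff less_Suc_eq
  by auto

lemma sum_lessThan_add: "(\<Sum>w<a + b. g w) = (\<Sum>w<a. g w) + (\<Sum>w<b. g (a + w))"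
  for g :: "nat \<Rightarrow> 'a :: comm_monoid_add"
  by (induction b) (simp_all add: add.assoc)

text \<open>The normalized partial trace over the m lowest qubits: XOR with all
  \<open>w < 2 ^ m\<close> runs through every setting of these bits, simultaneously in row and
  column.\<close>

lemma index_low_bits_avg:
  assumes "A \<in> carrier_mat (2 ^ n) (2 ^ n)" "m \<le> n" "x < 2 ^ n" "y < 2 ^ n"
  shows "low_bits_avg m A $$ (x, y) =
    (if take_bit m x = take_bit m y then (\<Sum>w<2 ^ m. A $$ (x XOR w, y XOR w)) / 2 ^ m else 0)"
  using assms
proof (induction m arbitrary: A)
  case (Suc m)
  let ?S = "\<lambda>k. \<Sum>w<2 ^ k. A $$ (x XOR w, y XOR w)"
  have entry: "bit_avg m A $$ (x XOR w, y XOR w) =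
    (if bit x m = bit y m then (A $$ (x XOR w, y XOR w) + A $$ (x XOR (2 ^ m + w), y XOR (2 ^ m + w))) / 2 else 0)"
    if w: "w < 2 ^ m" for w
  proof -
    have "w < 2 ^ n" using w Suc.prems(2) by (meson Suc_leD less_le_trans one_le_numeral power_increasing)
    then have less: "x XOR w < 2 ^ n" "y XOR w < 2 ^ n" using Suc.prems by (auto intro: xor_less_power)
    have nbit: "\<not> bit w m"
      using w by (metis bit_take_bit_iff less_irrefl take_bit_nat_eq_self_iff)
    \<comment> \<open>Since w has no bit m, flipping that bit adds \<open>2 ^ m\<close>. The two
      terms of \<open>bit_avg m\<close> therefore range over the lower and the upper half of the
      indices below \<open>2 ^ Suc m\<close>.\<close>
    have "w AND 2 ^ m = 0"
      using nbit by (intro bit_eqI) (auto simp: bit_and_iff bit_power_nat)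
    then have "w XOR 2 ^ m = 2 ^ m + w"
      by (simp add: disjunctive_add_eq_xor add.commute)
    then show ?thesis
      unfolding index_bit_avg[OF Suc.prems(1) less] by (simp add: bit_xor_iff nbit xor.assoc)
  qed
  have "low_bits_avg (Suc m) A $$ (x, y) =
    (if take_bit m x = take_bit m y then (\<Sum>w<2 ^ m. bit_avg m A $$ (x XOR w, y XOR w)) / 2 ^ m else 0)"
    using Suc.prems by (simp add: Suc.IH bit_avg_carrier)
  also have "(\<Sum>w<2 ^ m. bit_avg m A $$ (x XOR w, y XOR w)) = (if bit x m = bit y m then ?S (Suc m) / 2 else 0)"
    using sum_lessThan_add[of "\<lambda>w. A $$ (x XOR w, y XOR w)" "2 ^ m" "2 ^ m"]
    by (simp add: entry sum.distrib flip: sum_divide_distrib mult_2)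
  finally show ?case
    by (auto simp: take_bit_Suc_eq_iff)
qed simp

text \<open>With all bits averaged, agreement in the low bits means equality of the indices, and XOR
  with x permutes the diagonal, so every diagonal entry is the normalized trace.\<close>

lemma low_bits_avg_all:
  assumes A: "A \<in> carrier_mat (2 ^ n) (2 ^ n)"
  shows "low_bits_avg n A = (mat_trace A / 2 ^ n) \<cdot>\<^sub>m 1\<^sub>m (2 ^ n)"
proof (rule eq_matI)
  fix x y assume "x < dim_row ((mat_trace A / 2 ^ n) \<cdot>\<^sub>m 1\<^sub>m (2 ^ n))" "y < dim_col ((mat_trace A / 2 ^ n) \<cdot>\<^sub>m 1\<^sub>m (2 ^ n))"
  then have xy: "x < 2 ^ n" "y < 2 ^ n" by auto
  have "(\<Sum>w<2 ^ n. A $$ (x XOR w, x XOR w)) = (\<Sum>z<2 ^ n. A $$ (z, z))"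
    using xy by (intro sum.reindex_bij_witness[of _ "\<lambda>z. x XOR z" "\<lambda>z. x XOR z"])
      (auto simp: xor_less_power xor.assoc[symmetric])
  then show "low_bits_avg n A $$ (x, y) = ((mat_trace A / 2 ^ n) \<cdot>\<^sub>m 1\<^sub>m (2 ^ n)) $$ (x, y)"
    using xy by (cases "x = y") (simp_all add: index_low_bits_avg[OF A] take_bit_nat_eq_self mat_trace_carrier[OF A])
qed (use low_bits_avg_carrier[OF A, of n] in auto)

text \<open>Each step adds \<open>low_bits_avg m (A - bit_avg m A)\<close>; the outer average only
  decreases its norm.\<close>

lemma trace_norm_minus_low_bits_avg:
  assumes A: "A \<in> carrier_mat (2 ^ n) (2 ^ n)" and m: "m \<le> n"
  shows "trace_norm (A - low_bits_avg m A) \<le> (\<Sum>k<m. trace_norm (A - bit_avg k A))"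
  using m
proof (induction m)
  case 0
  have "A - A = 0\<^sub>m (2 ^ n) (2 ^ n)" using A by auto
  then show ?case by (simp add: trace_norm_zero)
next
  case (Suc m)
  note car = A bit_avg_carrier[OF A, of m] low_bits_avg_carrier[OF A, of m]
    low_bits_avg_carrier[OF bit_avg_carrier[OF A, of m], of m]
  let ?D = "low_bits_avg m (A - bit_avg m A)"
  have D: "?D = low_bits_avg m A - low_bits_avg m (bit_avg m A)"
    using Suc.prems car by (intro low_bits_avg_minus) auto
  have "A - low_bits_avg (Suc m) A = (A - low_bits_avg m A) + ?D"
    unfolding D using car by (intro eq_matI) auto
  then have "trace_norm (A - low_bits_avg (Suc m) A) \<le> trace_norm (A - low_bits_avg m A) + trace_norm ?D"
    using trace_norm_triangle[of "A - low_bits_avg m A" "2 ^ n" ?D] car by (simp add: D minus_carrier_mat)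
  also have "trace_norm ?D \<le> trace_norm (A - bit_avg m A)"
    using Suc.prems car by (intro trace_norm_low_bits_avg[of _ n]) (auto simp: minus_carrier_mat)
  finally show ?case using Suc by simp
qed

section \<open>Identification of \<open>qubit_diff\<close> with the identity minus a bit
  average\<close>

lemma qubit_bit: "qubit n k x = of_bool (bit x (n - k))"
  by (simp add: qubit_def bit_iff_odd odd_iff_mod_2_eq_one)

lemma sum_delta_pair:
  fixes f :: "nat \<Rightarrow> nat \<Rightarrow> complex"
  assumes "u < N" "v < N"
  shows "(\<Sum>a<N. \<Sum>b<N. f a b * of_bool (a = u \<and> b = v)) = f u v"
proof -
  have "(\<Sum>a<N. \<Sum>b<N. f a b * of_bool (a = u \<and> b = v)) = (\<Sum>a<N. if a = u then f a v else 0)"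
  proof (intro sum.cong refl)
    fix a
    have "(\<Sum>b<N. f a b * of_bool (a = u \<and> b = v)) = (\<Sum>b<N. if b = v then (if a = u then f a v else 0) else 0)"
      by (intro sum.cong) auto
    then show "(\<Sum>b<N. f a b * of_bool (a = u \<and> b = v)) = (if a = u then f a v else 0)"
      using assms by simp
  qed
  then show ?thesis using assms by simp
qed

lemma eq_iff_bits_less:
  fixes a x :: nat
  assumes "a < 2 ^ n" "x < 2 ^ n"
  shows "a = x \<longleftrightarrow> (\<forall>i<n. bit a i = bit x i)"
  using assms by (metis bit_take_bit_iff bit_eq_iff take_bit_nat_eq_self_iff)

text \<open>The coefficient of \<open>A $$ (a, b)\<close> in entry (x, y) of the image. The factors
  other than j force all other digits to agree; factor j contributes the same condition for its own
  digit, minus half the product of two Kronecker deltas.\<close>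

lemma qubit_diff_unit_entry:
  fixes a b x y :: nat
  assumes less: "a < 2 ^ n" "b < 2 ^ n" "x < 2 ^ n" "y < 2 ^ n" and j: "1 \<le> j" "j \<le> n"
  shows "(\<Prod>k\<in>{1..n}. (if k = j then center_map else (\<lambda>X. X))
      (mat_unit (qubit n k a) (qubit n k b)) $$ (qubit n k x, qubit n k y)) =
    of_bool (a = x \<and> b = y) - of_bool (bit x (n - j) = bit y (n - j)) / 2 *
      (of_bool (a = x \<and> b = y) + of_bool (a = x XOR 2 ^ (n - j) \<and> b = y XOR 2 ^ (n - j)))"
    (is "(\<Prod>k\<in>_. ?g k) = _")
proof -
  let ?c = "n - j"
  define same where "same u v \<longleftrightarrow> (\<forall>i<n. i \<noteq> ?c \<longrightarrow> bit u i = bit v i)" for u v :: nat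
  have c: "?c < n" using j by auto
  have eq1: "u = v \<longleftrightarrow> same u v \<and> bit u ?c = bit v ?c" if "u < 2 ^ n" "v < 2 ^ n" for u v
    using eq_iff_bits_less[OF that] c by (auto simp: same_def)
  have eq2: "u = v XOR 2 ^ ?c \<longleftrightarrow> same u v \<and> bit u ?c \<noteq> bit v ?c" if "u < 2 ^ n" "v < 2 ^ n" for u v
    using eq_iff_bits_less[OF that(1) xor_power_less[OF that(2) c]] c by (auto simp: same_def bit_xor_power)
  have "(\<Prod>k\<in>{1..n}. ?g k) = ?g j * (\<Prod>k\<in>{1..n} - {j}. ?g k)"
    using j by (intro prod.remove) auto
  also have "(\<Prod>k\<in>{1..n} - {j}. ?g k) =
      (\<Prod>k\<in>{1..n} - {j}. of_bool (bit a (n - k) = bit x (n - k) \<and> bit b (n - k) = bit y (n - k)))"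
    by (intro prod.cong) (auto simp: mat_unit_def qubit_bit)
  also have "\<dots> = of_bool (\<forall>k\<in>{1..n} - {j}. bit a (n - k) = bit x (n - k) \<and> bit b (n - k) = bit y (n - k))"
    by (induction rule: finite_induct[OF finite_Diff[OF finite_atLeastAtMost]]) auto
  also have "(\<forall>k\<in>{1..n} - {j}. bit a (n - k) = bit x (n - k) \<and> bit b (n - k) = bit y (n - k)) \<longleftrightarrow>
      same a x \<and> same b y"
  proof -
    have img: "(\<lambda>k. n - k) ` ({1..n} - {j}) = {..<n} - {?c}"
    proof (intro equalityI subsetI)
      fix i assume "i \<in> {..<n} - {?c}"
      then have "i = n - (n - i)" "n - i \<in> {1..n} - {j}" using j by auto
      then show "i \<in> (\<lambda>k. n - k) ` ({1..n} - {j})" by (rule image_eqI)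
    qed (use j in auto)
    have "(\<forall>k\<in>{1..n} - {j}. P (n - k)) \<longleftrightarrow> (\<forall>i\<in>(\<lambda>k. n - k) ` ({1..n} - {j}). P i)" for P
      by blast
    note reindex = this[unfolded img, of "\<lambda>i. bit a i = bit x i \<and> bit b i = bit y i"]
    show ?thesis unfolding reindex same_def by blast
  qed
  \<comment> \<open>The trace of the matrix unit is the delta of the digits of a and b, and the
    identity matrix gives the delta of the digits of x and y.\<close>
  also have "?g j = of_bool (bit a ?c = bit x ?c \<and> bit b ?c = bit y ?c) -
      of_bool (bit x ?c = bit y ?c) / 2 * of_bool (bit a ?c = bit b ?c)"
    by (auto simp: center_map_def mat_unit_def mat_trace_def qubit_bit eval_nat_numeral)
  \<comment> \<open>If x, y agree in bit \<open>?c\<close> and so do a, b, then (a, b) either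
    matches (x, y) there or has both bits flipped: these are the two summands of the
    bracket.\<close>
  finally show ?thesis
    unfolding eq1[OF less(1,3)] eq1[OF less(2,4)] eq2[OF less(1,3)] eq2[OF less(2,4)]
    by auto
qed

lemma qubit_diff_eq_minus_bit_avg:
  assumes A: "A \<in> carrier_mat (2 ^ n) (2 ^ n)" and j: "1 \<le> j" "j \<le> n"
  shows "qubit_diff n j A = A - bit_avg (n - j) A"
proof (rule eq_matI)
  let ?c = "n - j"
  show "dim_row (qubit_diff n j A) = dim_row (A - bit_avg ?c A)"
    "dim_col (qubit_diff n j A) = dim_col (A - bit_avg ?c A)"
    using A by (simp_all add: qubit_diff_def tensor_map_def bit_avg_def)
  fix x y assume "x < dim_row (A - bit_avg ?c A)" "y < dim_col (A - bit_avg ?c A)"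
  then have xy: "x < 2 ^ n" "y < 2 ^ n" using A by (simp_all add: bit_avg_def)
  have c: "?c < n" using j by auto
  note xy' = xor_power_less[OF xy(1) c] xor_power_less[OF xy(2) c]
  let ?\<delta> = "of_bool (bit x ?c = bit y ?c) / 2 :: complex"
  have "qubit_diff n j A $$ (x, y) = (\<Sum>a<2 ^ n. \<Sum>b<2 ^ n. A $$ (a, b) *
      (\<Prod>k\<in>{1..n}. (if k = j then center_map else (\<lambda>X. X))
        (mat_unit (qubit n k a) (qubit n k b)) $$ (qubit n k x, qubit n k y)))"
    using xy by (simp add: qubit_diff_def tensor_map_def tensor_mat_def)
  also have "\<dots> = (\<Sum>a<2 ^ n. \<Sum>b<2 ^ n. A $$ (a, b) *
      (of_bool (a = x \<and> b = y) - ?\<delta> *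
        (of_bool (a = x \<and> b = y) + of_bool (a = x XOR 2 ^ ?c \<and> b = y XOR 2 ^ ?c))))"
    by (intro sum.cong refl arg_cong[of _ _ "(*) _"] qubit_diff_unit_entry[OF _ _ xy j]) auto
  also have "\<dots> = (\<Sum>a<2 ^ n. \<Sum>b<2 ^ n. A $$ (a, b) * of_bool (a = x \<and> b = y)) - ?\<delta> *
      ((\<Sum>a<2 ^ n. \<Sum>b<2 ^ n. A $$ (a, b) * of_bool (a = x \<and> b = y)) +
       (\<Sum>a<2 ^ n. \<Sum>b<2 ^ n. A $$ (a, b) * of_bool (a = x XOR 2 ^ ?c \<and> b = y XOR 2 ^ ?c)))"
    by (simp only: right_diff_distrib distrib_left sum_subtractf sum.distrib sum_distrib_left mult.left_commute[of _ ?\<delta>])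
  also have "\<dots> = A $$ (x, y) - ?\<delta> * (A $$ (x, y) + A $$ (x XOR 2 ^ ?c, y XOR 2 ^ ?c))"
    by (simp only: sum_delta_pair[OF xy, of "\<lambda>a b. A $$ (a, b)"] sum_delta_pair[OF xy', of "\<lambda>a b. A $$ (a, b)"])
  also have "\<dots> = (A - bit_avg ?c A) $$ (x, y)"
    using xy A by (simp add: bit_avg_def)
  finally show "qubit_diff n j A $$ (x, y) = (A - bit_avg ?c A) $$ (x, y)" .
qed

theorem theorem3p1:
  fixes n :: nat and A :: "complex mat"
  assumes "n \<ge> 1" and "A \<in> carrier_mat (2 ^ n) (2 ^ n)"
  shows "schatten1 n (A - (mat_trace A / 2 ^ n) \<cdot>\<^sub>m 1\<^sub>m (2 ^ n))
           \<le> (\<Sum>j = 1..n. schatten1 n (qubit_diff n j A))"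
proof -
  have norm: "schatten1 n X = trace_norm X / 2 ^ n" for X
    by (simp add: schatten1_def trace_norm_def)
  have "trace_norm (A - (mat_trace A / 2 ^ n) \<cdot>\<^sub>m 1\<^sub>m (2 ^ n)) \<le> (\<Sum>k<n. trace_norm (A - bit_avg k A))"
    using trace_norm_minus_low_bits_avg[OF assms(2) order_refl] by (simp add: low_bits_avg_all[OF assms(2)])
  \<comment> \<open>Bits 0 to n - 1 are the qubits n down to 1.\<close>
  also have "\<dots> = (\<Sum>j = 1..n. trace_norm (A - bit_avg (n - j) A))"
    by (rule sum.reindex_bij_witness[of _ "\<lambda>j. n - j" "\<lambda>k. n - k"]) auto
  also have "\<dots> = (\<Sum>j = 1..n. trace_norm (qubit_diff n j A))"
    using assms(2) by (intro sum.cong) (auto simp: qubit_diff_eq_minus_bit_avg)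
  finally show ?thesis
    by (simp add: norm divide_right_mono flip: sum_divide_distrib)
qed

end
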